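(* Let $(c_k)_{k\ge 1}$ be a sequence of non-negative real numbers such that $C(x)=\sum_{k\ge 1}c_kx^k$ is subexponential with radius of convergence $\rho$, where $0<\rho<1$. Let $m=\min\{k\in\mathbb{N}: c_k>0\}$ and let $$G(x,y)=\exp\Big(\sum_{j\ge 1}y^j\frac{C(x^j)}{j}\Big).$$ Then, as $n,N,n-mN\to\infty$, $$[x^ny^N]G(x,y)\sim A\cdot N^{c_m-1}\cdot c_{n-m(N-1)},$$ where $$A=\frac{1}{\Gamma(c_m)}\exp\Big(\sum_{j\ge 1}\frac{C(\rho^j)-c_m\rho^{jm}}{j\rho^{jm}}\Big).$$
   Context: $\mathbb{N}=\{1,2,\dots\}$. Put $c_0=0$. The power series $C(x)=\sum_{k\ge1}c_kx^k$ with non-negative real coefficients is called subexponential with radius of convergence $\rho>0$ if $c_n>0$ for all large $n$ and, as $n\to\infty$, $c_{n-1}/c_n\to\rho$ and $c_n^{-1}\sum_{1\le k\le n}c_kc_{n-k}\to 2C(\rho)<\infty$. $[x^ny^N]G(x,y)$ is the coefficient of $x^ny^N$ in the formal power series $G(x,y)$. $\Gamma(\cdot)$ is the Gamma function. "$a\sim b$ as $n,N,n-mN\to\infty$" means that $a/b\to1$ along every sequence of pairs $(n,N)\in\mathbb{N}^2$ for which $n\to\infty$, $N\to\infty$ and $n-mN\to\infty$. *)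

theory Defs
  imports "HOL-Analysis.Analysis"
begin

definition subexponential :: "real fps \<Rightarrow> real \<Rightarrow> bool" where
  "subexponential C \<rho> \<longleftrightarrow>
     \<rho> > 0 \<and>
     fps_nth C 0 = 0 \<and> (\<forall>k. fps_nth C k \<ge> 0) \<and>
     (\<forall>\<^sub>F n in sequentially. fps_nth C n > 0) \<and>
     (\<lambda>n. fps_nth C (n - 1) / fps_nth C n) \<longlonglongrightarrow> \<rho> \<and>
     summable (\<lambda>k. fps_nth C k * \<rho> ^ k) \<and>
     (\<lambda>n. (\<Sum>k=1..n. fps_nth C k * fps_nth C (n - k)) / fps_nth C n)
       \<longlonglongrightarrow> 2 * eval_fps C \<rho>"

text \<open>
  Bivariate formal power series in \<open>x\<close> and \<open>y\<close> are elements of \<open>real fps fps\<close>: the outer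
  variable is \<open>y\<close> and the coefficients are series in \<open>x\<close>. The coefficient of
  \<open>x^n y^N\<close> in \<open>F\<close> is therefore \<open>fps_nth (fps_nth F N) n\<close>.
\<close>

definition coeff_xy :: "real fps fps \<Rightarrow> nat \<Rightarrow> nat \<Rightarrow> real" where
  "coeff_xy F n N = fps_nth (fps_nth F N) n"

text \<open>
  The library series \<open>fps_exp\<close> needs coefficients in a field, which \<open>real fps\<close> is not.
  Composition has its intended meaning here only if \<open>F\<close> has zero constant term in \<open>y\<close>.
\<close>

definition formal_exp :: "real fps fps \<Rightarrow> real fps fps" where
  "formal_exp F = fps_compose (Abs_fps (\<lambda>k. fps_const (1 / fact k))) F"

text \<open>The coefficient of \<open>y^j\<close> in the exponent is \<open>C(x^j) / j\<close> for \<open>j \<ge> 1\<close>.\<close>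

definition G_series :: "real fps \<Rightarrow> real fps fps" where
  "G_series C = formal_exp
     (Abs_fps (\<lambda>j. if j = 0 then 0
                   else fps_const (1 / real j) * fps_compose C (fps_X ^ j)))"

definition A_term :: "real fps \<Rightarrow> real \<Rightarrow> nat \<Rightarrow> nat \<Rightarrow> real" where
  "A_term C \<rho> m j =
     (eval_fps C (\<rho> ^ j) - fps_nth C m * \<rho> ^ (j * m)) / (real j * \<rho> ^ (j * m))"

text \<open>The sum over \<open>j \<ge> 1\<close> is indexed from 0 by \<open>Suc\<close>.\<close>

definition A_const :: "real fps \<Rightarrow> real \<Rightarrow> nat \<Rightarrow> real" where
  "A_const C \<rho> m = 1 / Gamma (fps_nth C m) * exp (\<Sum>j. A_term C \<rho> m (Suc j))"

end

(*
  Write C = x^m (a + E) with a = c_m and E(0) = 0. Substituting y x^(-m) for y factors G as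
  (1 - y)^(-a) exp (sum_j y^j E(x^j) / j), so with r = n - mN the coefficient in question is
  sum_M b_(N-M) P_M[x^r], where b_k = (a)_k / k! and the second factor is sum_M P_M(x) y^M.
  The recursion M P_M = sum_j E(x^j) P_(M-j) and the product rule for coefficient asymptotics
  relative to c give P_M[x^r] ~ P_(M-1)(rho) [x^r]E for fixed M, because E(x^j) with j >= 2 is
  negligible. The same recursion gives the uniform bound P_M[x^r] <= K q^M (kappa)_M / M! c_r
  with q = rho^(1/4) < 1, while b_(N-M) / b_N tends to 1 and is O(M + 1). Hence Tannery's theorem
  yields sum_M P_M(rho) = exp (sum_j E(rho^j) / j) in the limit, and b_N ~ N^(a-1) / Gamma(a).
*)
theory Submission
  imports Defs "HOL-Computational_Algebra.Formal_Laurent_Series"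
begin

subsection \<open>Recursions from the logarithmic derivative\<close>

text \<open>The number a is split off because the exponent contains infinitely many series: a
  constant term would enter every C(x^j) / x^(jm) at full size, whereas E(0) = 0 makes E(x^j) vanish
  below x^j, and this is what allows a factor q^j to be gained. The constants are collected in a
  factor that is explicit. The obstacle is uniformity. Since N grows together with n, asymptotics
  for each fixed M do not suffice, and P_M has to be dominated for all M and r at once. The fourth
  root leaves room for this between the coefficients of E, which are O(q^(-4k)), and c_n, which
  eventually exceeds q^(-3n). The number \<kappa> is the product of the constant in the resulting
  bound for E(x^j) and the constant in the convolution bound for c; the majorant is (1 -
  qy)^(-\<kappa>). The constant \<rho>^(-m) in [x^r]E ~ \<rho>^(-m) c_r is what turns c_r into
  c_(r+m) = c_(n-m(N-1)).\<close>

lemma fps_deriv_eq_mult_iff: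
  fixes f :: "'a :: comm_ring_1 fps" and S :: "nat \<Rightarrow> 'a"
  shows "fps_deriv f = f * Abs_fps (\<lambda>j. S (Suc j)) \<longleftrightarrow>
    (\<forall>M. of_nat M * fps_nth f M = (\<Sum>i<M. fps_nth f i * S (M - i)))"
    (is "_ \<longleftrightarrow> ?R")
proof -
  have "(\<Sum>i=0..M. fps_nth f i * S (Suc (M - i))) = (\<Sum>i<Suc M. fps_nth f i * S (Suc M - i))" for M
    by (intro sum.cong) (auto simp: Suc_diff_le)
  then have "fps_deriv f = f * Abs_fps (\<lambda>j. S (Suc j)) \<longleftrightarrow>
     (\<forall>M. of_nat (Suc M) * fps_nth f (Suc M) = (\<Sum>i<Suc M. fps_nth f i * S (Suc M - i)))"
    by (simp only: fps_eq_iff fps_mult_nth fps_deriv_nth fps_nth_Abs_fps Suc_eq_plus1)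
  also have "\<dots> \<longleftrightarrow> ?R"
  proof
    assume *: "\<forall>M. of_nat (Suc M) * fps_nth f (Suc M) = (\<Sum>i<Suc M. fps_nth f i * S (Suc M - i))"
    show ?R
    proof
      fix M
      show "of_nat M * fps_nth f M = (\<Sum>i<M. fps_nth f i * S (M - i))"
        using * by (cases M) auto
    qed
  qed blast
  finally show ?thesis .
qed

text \<open>The recursion fixes each coefficient by the earlier ones once \<open>of_nat M\<close>
  cancels, hence a domain of characteristic zero; it is applied with coefficients in
  \<open>real fps\<close>. Exponentials are identified by comparing logarithmic derivatives and
  constant terms.\<close>

lemma fps_deriv_eq_mult_unique:
  fixes f g :: "'a :: {idom, semiring_char_0} fps" and S :: "nat \<Rightarrow> 'a"
  assumes "fps_deriv f = f * Abs_fps (\<lambda>j. S (Suc j))"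
    and "fps_deriv g = g * Abs_fps (\<lambda>j. S (Suc j))"
    and "fps_nth f 0 = fps_nth g 0"
  shows "f = g"
proof (rule fps_ext)
  fix M
  show "fps_nth f M = fps_nth g M"
  proof (induction M rule: less_induct)
    case (less M)
    show ?case
    proof (cases M)
      case (Suc k)
      have "of_nat M * fps_nth f M = (\<Sum>i<M. fps_nth f i * S (M - i))"
        using assms(1) unfolding fps_deriv_eq_mult_iff by blast
      also have "\<dots> = (\<Sum>i<M. fps_nth g i * S (M - i))"
        using less by (intro sum.cong) auto
      also have "\<dots> = of_nat M * fps_nth g M"
        using assms(2) unfolding fps_deriv_eq_mult_iff by metis
      finally have "of_nat M * fps_nth f M = of_nat M * fps_nth g M" .
      then show ?thesis using Suc by (simp del: of_nat_Suc)
    qed (use assms(3) in simp)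
  qed
qed

lemma fps_deriv_formal_exp:
  assumes "fps_nth F 0 = 0"
  shows "fps_deriv (formal_exp F) = formal_exp F * fps_deriv F"
proof -
  have "fps_deriv (Abs_fps (\<lambda>k. fps_const (1 / fact k :: real)))
      = Abs_fps (\<lambda>k. fps_const (1 / fact k))"
  proof (rule fps_ext)
    fix n
    have "of_nat (Suc n) * fps_const (1 / fact (Suc n) :: real) = fps_const (1 / fact n)"
      unfolding fps_of_nat [symmetric] fps_const_mult by (simp del: of_nat_Suc)
    then show "fps_nth (fps_deriv (Abs_fps (\<lambda>k. fps_const (1 / fact k :: real)))) n
        = fps_nth (Abs_fps (\<lambda>k. fps_const (1 / fact k))) n"
      by simp
  qed
  then show ?thesis
    using assms by (simp add: formal_exp_def fps_compose_deriv)
qed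

lemma fps_deriv_G_series:
  "fps_deriv (G_series C) = G_series C * Abs_fps (\<lambda>j. fps_compose C (fps_X ^ Suc j))"
proof -
  have "fps_deriv (Abs_fps (\<lambda>j. if j = 0 then 0
      else fps_const (1 / real j) * fps_compose C (fps_X ^ j)))
      = Abs_fps (\<lambda>j. fps_compose C (fps_X ^ Suc j))"
  proof (rule fps_ext)
    fix n
    have "of_nat (Suc n) * fps_const (1 / real (Suc n)) = (1 :: real fps)"
      unfolding fps_of_nat [symmetric] fps_const_mult by (simp del: of_nat_Suc)
    then have "of_nat (Suc n) * (fps_const (1 / real (Suc n)) * fps_compose C (fps_X ^ Suc n))
        = fps_compose C (fps_X ^ Suc n)"
      unfolding mult.assoc [symmetric] by (simp only: mult_1)
    then show "fps_nth (fps_deriv (Abs_fps (\<lambda>j. if j = 0 then 0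
      else fps_const (1 / real j) * fps_compose C (fps_X ^ j)))) n
      = fps_nth (Abs_fps (\<lambda>j. fps_compose C (fps_X ^ Suc j))) n"
      by simp
  qed
  then show ?thesis
    unfolding G_series_def by (simp only: fps_deriv_formal_exp fps_nth_Abs_fps if_True refl)
qed

lemma G_series_nth_0 [simp]: "fps_nth (G_series C) 0 = 1"
  by (simp add: G_series_def formal_exp_def)

lemma G_series_recursion:
  "of_nat M * fps_nth (G_series C) M =
    (\<Sum>i<M. fps_nth (G_series C) i * fps_compose C (fps_X ^ (M - i)))"
  using iffD1 [OF fps_deriv_eq_mult_iff [where S = "\<lambda>j. fps_compose C (fps_X ^ j)"] fps_deriv_G_series]
  by (rule spec)

section \<open>Coefficients of (1 - y)^(-a)\<close>

definition rising :: "real \<Rightarrow> nat \<Rightarrow> real" where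
  "rising a n = pochhammer a n / fact n"

lemma rising_0 [simp]: "rising a 0 = 1"
  by (simp add: rising_def)

lemma rising_Suc: "rising a (Suc n) = rising a n * (a + n) / Suc n"
  by (simp add: rising_def pochhammer_Suc)

lemma rising_pos: "a > 0 \<Longrightarrow> rising a n > 0"
  by (simp add: rising_def pochhammer_pos)

lemma rising_nonzero [simp]: "a > 0 \<Longrightarrow> rising a n \<noteq> 0"
  using rising_pos [of a n] by simp

text \<open>The logarithmic derivative of (1 - y)^(-a) is a / (1 - y), all of whose coefficients
  equal a. With \<kappa> in place of a, the same identity closes the induction in
  \<open>P_bound\<close>.\<close>

lemma rising_recursion: "real n * rising a n = (\<Sum>i<n. rising a i * a)"
proof (induction n)
  case (Suc n)
  have "real (Suc n) * rising a (Suc n) = rising a n * (a + n)"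
    by (simp add: rising_Suc)
  then show ?case using Suc by (simp add: algebra_simps)
qed simp

text \<open>The quotient of consecutive values is at least a / (a + 1) at the first step, and at
  least M / (M + 1) at the step from k + M to k + M + 1; these latter bounds telescope to 1 / M. The
  estimate is uniform in k. For a < 1 the values decrease, and some growth in M is
  unavoidable.\<close>

lemma rising_le:
  assumes "a > 0" "M \<ge> 1"
  shows "rising a k \<le> (1 + 1 / a) * real M * rising a (k + M)"
  using assms(2)
proof (induction M rule: dec_induct)
  case base
  have "real k + 1 \<le> (1 + 1 / a) * (a + k)"
    using assms(1) by (simp add: field_simps)
  then have "1 \<le> (1 + 1 / a) * ((a + k) / Suc k)"
    by (simp add: field_simps)
  then have "rising a k * 1 \<le> rising a k * ((1 + 1 / a) * ((a + k) / Suc k))"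
    using rising_pos [OF assms(1), of k] by (intro mult_left_mono) auto
  then show ?case by (simp add: rising_Suc mult_ac)
next
  case (step M)
  have "real M * Suc (k + M) \<le> real (Suc M * (k + M))"
    by (simp add: algebra_simps)
  also have "real (Suc M * (k + M)) \<le> Suc M * (a + real (k + M))"
    unfolding of_nat_mult using assms(1) by (intro mult_left_mono) auto
  finally have "real M \<le> Suc M * ((a + real (k + M)) / Suc (k + M))"
    by (simp add: field_simps)
  then have "real M * rising a (k + M)
      \<le> Suc M * ((a + real (k + M)) / Suc (k + M)) * rising a (k + M)"
    using rising_pos [OF assms(1), of "k + M"] by (intro mult_right_mono) auto
  also have "\<dots> = Suc M * rising a (k + Suc M)"
    by (simp add: rising_Suc)
  finally have "(1 + 1 / a) * (real M * rising a (k + M))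
      \<le> (1 + 1 / a) * (Suc M * rising a (k + Suc M))"
    using assms(1) by (intro mult_left_mono) auto
  with step.IH show ?case by (simp add: mult_ac)
qed

text \<open>This is the reciprocal of the product formula of Gauss: \<open>Gamma_series'\<close> is
  (n - 1)! n^a over the Pochhammer symbol, and writing (n - 1)! as n! / n lowers the exponent to a -
  1.\<close>

lemma rising_asymp:
  assumes "a > 0"
  shows "(\<lambda>n. rising a n / (real n powr (a - 1))) \<longlonglongrightarrow> 1 / Gamma a"
proof -
  have "(\<lambda>n. 1 / Gamma_series' a n) \<longlonglongrightarrow> 1 / Gamma a"
    using Gamma_real_pos [OF assms] by (intro tendsto_intros Gamma_series'_LIMSEQ) auto
  moreover have "\<forall>\<^sub>F n in sequentially. 1 / Gamma_series' a n = rising a n / (real n powr (a - 1))"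
    using eventually_gt_at_top [of 0]
  proof eventually_elim
    case (elim n)
    then have "fact n = real n * fact (n - 1)"
      by (simp add: fact_reduce)
    moreover have "real n powr a = real n * real n powr (a - 1)"
      using elim by (simp add: powr_mult_base)
    moreover have "exp (a * ln (real n)) = real n powr a"
      using elim by (simp add: powr_def)
    ultimately show ?case
      using elim unfolding Gamma_series'_def rising_def by (simp add: divide_simps)
  qed
  ultimately show ?thesis by (rule Lim_transform_eventually)
qed

lemma rising_Suc_ratio:
  assumes "a > 0"
  shows "(\<lambda>n. rising a (Suc n) / rising a n) \<longlonglongrightarrow> 1"
proof -
  have "(\<lambda>n. 1 + (a - 1) * inverse (real (Suc n))) \<longlonglongrightarrow> 1 + (a - 1) * 0"
    by (intro tendsto_intros LIMSEQ_inverse_real_of_nat)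
  moreover have "1 + (a - 1) * inverse (real (Suc n)) = rising a (Suc n) / rising a n" for n
    using rising_pos [OF assms, of n] by (simp add: rising_Suc divide_simps)
  ultimately show ?thesis by simp
qed

lemma rising_diff_ratio:
  assumes "a > 0"
  shows "(\<lambda>n. rising a (n - M) / rising a n) \<longlonglongrightarrow> 1"
proof (induction M)
  case 0
  then show ?case using assms by simp
next
  case (Suc M)
  have "(\<lambda>n. rising a n / rising a (Suc n)) \<longlonglongrightarrow> 1"
    using tendsto_divide [OF tendsto_const [of 1] rising_Suc_ratio [OF assms]] by simp
  from tendsto_mult [OF Suc this]
  have "(\<lambda>n. rising a (n - M) / rising a (Suc n)) \<longlonglongrightarrow> 1"
    using assms by simp
  then have "(\<lambda>n. rising a (Suc n - Suc M) / rising a (Suc n)) \<longlonglongrightarrow> 1"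
    by simp
  then show ?case by (subst (asm) filterlim_sequentially_Suc)
qed

text \<open>The factor \<open>Suc M\<close> pays for the loss in \<open>rising_le\<close>. It and
  \<open>rising\<close> both have consecutive quotients tending to 1, so those of the terms tend to
  q, and the midpoint of q and 1 serves in the ratio test.\<close>

lemma summable_linear_power_rising:
  assumes "a > 0" "0 < q" "q < 1"
  shows "summable (\<lambda>M. real (Suc M) * (q ^ M * rising a M))"
proof -
  have "(\<lambda>n. (1 + inverse (real (Suc n))) * q * (rising a (Suc n) / rising a n)) \<longlonglongrightarrow> (1 + 0) * q * 1"
    by (intro tendsto_intros LIMSEQ_inverse_real_of_nat rising_Suc_ratio assms)
  then have "\<forall>\<^sub>F n in sequentially. (1 + inverse (real (Suc n))) * q * (rising a (Suc n) / rising a n) < (1 + q) / 2"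
    by (rule order_tendstoD) (use assms in auto)
  then obtain N where N: "\<And>n. n \<ge> N \<Longrightarrow>
      (1 + inverse (real (Suc n))) * q * (rising a (Suc n) / rising a n) < (1 + q) / 2"
    unfolding eventually_sequentially by blast
  show ?thesis
  proof (rule summable_ratio_test)
    fix n assume "n \<ge> N"
    have "norm (real (Suc (Suc n)) * (q ^ Suc n * rising a (Suc n)))
        = (1 + inverse (real (Suc n))) * q * (rising a (Suc n) / rising a n)
          * norm (real (Suc n) * (q ^ n * rising a n))"
      using rising_pos [OF assms(1), of n] rising_pos [OF assms(1), of "Suc n"] assms(2)
      by (simp add: abs_mult divide_simps)
    also have "\<dots> \<le> (1 + q) / 2 * norm (real (Suc n) * (q ^ n * rising a n))"
      using N [OF \<open>n \<ge> N\<close>] by (intro mult_right_mono) auto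
    finally show "norm (real (Suc (Suc n)) * (q ^ Suc n * rising a (Suc n)))
      \<le> (1 + q) / 2 * norm (real (Suc n) * (q ^ n * rising a n))" .
  qed (use assms in simp)
qed

subsection \<open>Products of series asymptotic to a subexponential one\<close>

text \<open>The condition on L keeps the two end blocks disjoint. In the remaining block both
  indices are at least L, so bounds that hold from L on apply to both factors at once.\<close>

lemma fps_mult_nth_split:
  fixes f g :: "'a :: comm_ring_1 fps"
  assumes "2 * L \<le> n"
  shows "fps_nth (f * g) n = (\<Sum>k<L. fps_nth f k * fps_nth g (n - k))
    + (\<Sum>k<L. fps_nth g k * fps_nth f (n - k)) + (\<Sum>k=L..n-L. fps_nth f k * fps_nth g (n - k))"
proof -
  let ?h = "\<lambda>k. fps_nth f k * fps_nth g (n - k)"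
  have "{0..n} = ({..<L} \<union> {L..n-L}) \<union> {n-L<..n}"
    using assms by auto
  then have "fps_nth (f * g) n = sum ?h (({..<L} \<union> {L..n-L}) \<union> {n-L<..n})"
    by (simp add: fps_mult_nth)
  also have "\<dots> = sum ?h ({..<L} \<union> {L..n-L}) + sum ?h {n-L<..n}"
    using assms by (intro sum.union_disjoint) auto
  also have "sum ?h ({..<L} \<union> {L..n-L}) = sum ?h {..<L} + sum ?h {L..n-L}"
    by (intro sum.union_disjoint) auto
  also have "sum ?h {n-L<..n} = (\<Sum>k<L. fps_nth g k * fps_nth f (n - k))"
    using assms by (intro sum.reindex_bij_witness [of _ "\<lambda>k. n - k" "\<lambda>k. n - k"]) auto
  finally show ?thesis by simp
qed

text \<open>Stated with absolute summability at the point itself, because it is used at x = \<rho>,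
  on the boundary of the disc of convergence.\<close>

lemma sums_fps_mult:
  fixes f g :: "real fps"
  assumes "summable (\<lambda>n. \<bar>fps_nth f n\<bar> * x ^ n)" "summable (\<lambda>n. \<bar>fps_nth g n\<bar> * x ^ n)" "0 \<le> x"
  shows "(\<lambda>n. fps_nth (f * g) n * x ^ n) sums (eval_fps f x * eval_fps g x)"
proof -
  have "(\<lambda>n. \<Sum>i\<le>n. (fps_nth f i * x ^ i) * (fps_nth g (n - i) * x ^ (n - i)))
      sums ((\<Sum>n. fps_nth f n * x ^ n) * (\<Sum>n. fps_nth g n * x ^ n))"
    using assms by (intro Cauchy_product_sums) (simp_all add: abs_mult)
  moreover have "(\<Sum>i\<le>n. (fps_nth f i * x ^ i) * (fps_nth g (n - i) * x ^ (n - i)))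
      = fps_nth (f * g) n * x ^ n" for n
    unfolding fps_mult_nth sum_distrib_right atMost_atLeast0
    by (intro sum.cong) (auto simp: mult_ac simp flip: power_add)
  ultimately show ?thesis by (simp add: eval_fps_def)
qed

locale subexponential_series =
  fixes C :: "real fps" and \<rho> :: real
  assumes subexp: "subexponential C \<rho>" and rho_less_1: "\<rho> < 1"
begin

abbreviation c :: "nat \<Rightarrow> real" where "c \<equiv> fps_nth C"

lemma rho_pos: "\<rho> > 0"
  and c_0: "c 0 = 0"
  and c_nonneg: "c k \<ge> 0"
  and c_eventually_pos: "\<forall>\<^sub>F n in sequentially. c n > 0"
  and c_ratio: "(\<lambda>n. c (n - 1) / c n) \<longlonglongrightarrow> \<rho>"
  and c_summable: "summable (\<lambda>k. c k * \<rho> ^ k)"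
  using subexp by (auto simp: subexponential_def)

lemma c_convolution: "(\<lambda>n. fps_nth (C * C) n / c n) \<longlonglongrightarrow> 2 * eval_fps C \<rho>"
proof -
  have "fps_nth (C * C) n = (\<Sum>k=1..n. c k * c (n - k))" for n
    unfolding fps_mult_nth by (subst sum.atLeast_Suc_atMost) (auto simp: c_0)
  then show ?thesis using subexp by (simp add: subexponential_def)
qed

lemma c_shift_ratio: "(\<lambda>n. c (n - k) / c n) \<longlonglongrightarrow> \<rho> ^ k"
proof (induction k)
  case 0
  have "\<forall>\<^sub>F n in sequentially. 1 = c (n - 0) / c n"
    using c_eventually_pos by eventually_elim simp
  then show ?case by (auto intro: Lim_transform_eventually [OF tendsto_const])
next
  case (Suc k)
  have "(\<lambda>n. c (n - k - 1) / c (n - k)) \<longlonglongrightarrow> \<rho>"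
    by (rule filterlim_compose [OF c_ratio filterlim_minus_const_nat_at_top])
  from tendsto_mult [OF this Suc]
  have "(\<lambda>n. c (n - k - 1) / c (n - k) * (c (n - k) / c n)) \<longlonglongrightarrow> \<rho> ^ Suc k"
    by simp
  moreover have "\<forall>\<^sub>F n in sequentially. c (n - k) > 0"
    using c_eventually_pos filterlim_minus_const_nat_at_top
    by (rule eventually_compose_filterlim)
  then have "\<forall>\<^sub>F n in sequentially.
      c (n - k - 1) / c (n - k) * (c (n - k) / c n) = c (n - Suc k) / c n"
    by eventually_elim simp
  ultimately show ?case by (rule Lim_transform_eventually)
qed

lemma c_add_ratio: "(\<lambda>n. c (n + k) / c n) \<longlonglongrightarrow> 1 / \<rho> ^ k"
proof -
  have "(\<lambda>n. c n / c (n + k)) \<longlonglongrightarrow> \<rho> ^ k"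
    using filterlim_compose [OF c_shift_ratio filterlim_add_const_nat_at_top, of k k] by simp
  from tendsto_divide [OF tendsto_const [of 1] this] show ?thesis
    using rho_pos by simp
qed

lemma asymp_shift:
  assumes "(\<lambda>n. fps_nth f n / c n) \<longlonglongrightarrow> \<alpha>"
  shows "(\<lambda>n. fps_nth f (n - k) / c n) \<longlonglongrightarrow> \<alpha> * \<rho> ^ k"
proof -
  have "(\<lambda>n. fps_nth f (n - k) / c (n - k)) \<longlonglongrightarrow> \<alpha>"
    by (rule filterlim_compose [OF assms filterlim_minus_const_nat_at_top])
  from tendsto_mult [OF this c_shift_ratio]
  have "(\<lambda>n. fps_nth f (n - k) / c (n - k) * (c (n - k) / c n)) \<longlonglongrightarrow> \<alpha> * \<rho> ^ k" .
  moreover have "\<forall>\<^sub>F n in sequentially. c (n - k) > 0"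
    using c_eventually_pos filterlim_minus_const_nat_at_top
    by (rule eventually_compose_filterlim)
  then have "\<forall>\<^sub>F n in sequentially.
      fps_nth f (n - k) / c (n - k) * (c (n - k) / c n) = fps_nth f (n - k) / c n"
    by eventually_elim simp
  ultimately show ?thesis by (rule Lim_transform_eventually)
qed

lemma asymp_bound:
  assumes "(\<lambda>n. fps_nth f n / c n) \<longlonglongrightarrow> \<alpha>"
  shows "\<forall>\<^sub>F n in sequentially. \<bar>fps_nth f n\<bar> \<le> (\<bar>\<alpha>\<bar> + 1) * c n"
proof -
  have "\<forall>\<^sub>F n in sequentially. \<bar>fps_nth f n / c n\<bar> < \<bar>\<alpha>\<bar> + 1"
    by (rule order_tendstoD [OF tendsto_rabs [OF assms]]) simp
  with c_eventually_pos show ?thesis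
    by eventually_elim (simp add: field_simps)
qed

lemma asymp_summable:
  assumes "(\<lambda>n. fps_nth f n / c n) \<longlonglongrightarrow> \<alpha>"
  shows "summable (\<lambda>n. \<bar>fps_nth f n\<bar> * \<rho> ^ n)"
proof (rule summable_comparison_test_ev)
  show "summable (\<lambda>n. (\<bar>\<alpha>\<bar> + 1) * (c n * \<rho> ^ n))"
    by (intro summable_mult c_summable)
  show "\<forall>\<^sub>F n in sequentially. norm (\<bar>fps_nth f n\<bar> * \<rho> ^ n) \<le> (\<bar>\<alpha>\<bar> + 1) * (c n * \<rho> ^ n)"
    using asymp_bound [OF assms]
  proof eventually_elim
    case (elim n)
    then have "\<bar>fps_nth f n\<bar> * \<rho> ^ n \<le> (\<bar>\<alpha>\<bar> + 1) * c n * \<rho> ^ n"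
      using rho_pos by (intro mult_right_mono) auto
    then show ?case using rho_pos by (simp add: mult_ac)
  qed
qed

lemma asymp_partial_sums:
  assumes "(\<lambda>n. fps_nth f n / c n) \<longlonglongrightarrow> \<alpha>"
  shows "(\<lambda>L. \<Sum>k<L. fps_nth f k * \<rho> ^ k) \<longlonglongrightarrow> eval_fps f \<rho>"
proof -
  have "summable (\<lambda>n. fps_nth f n * \<rho> ^ n)"
    using asymp_summable [OF assms] rho_pos
    by (intro summable_rabs_cancel [of "\<lambda>n. fps_nth f n * \<rho> ^ n"]) (simp add: abs_mult)
  then show ?thesis unfolding eval_fps_def by (rule summable_LIMSEQ)
qed

text \<open>For fixed L the two end blocks, divided by c_n, converge to the claimed limit with
  partial sums up to L in place of the values at \<rho>. The middle block is at most a constant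
  times the middle block of C * C, which is what remains of C * C without its own ends: relative to
  c_n it tends to 2 C(\<rho>) minus twice a partial sum, and this is small for large L. Here the
  convolution condition enters.\<close>

lemma asymp_mult:
  assumes f: "(\<lambda>n. fps_nth f n / c n) \<longlonglongrightarrow> \<alpha>"
    and g: "(\<lambda>n. fps_nth g n / c n) \<longlonglongrightarrow> \<beta>"
  shows "(\<lambda>n. fps_nth (f * g) n / c n) \<longlonglongrightarrow> \<alpha> * eval_fps g \<rho> + \<beta> * eval_fps f \<rho>"
proof (rule tendstoI)
  fix \<epsilon> :: real assume "\<epsilon> > 0"
  define psum where "psum = (\<lambda>h L. \<Sum>k<L. fps_nth h k * \<rho> ^ k)"
  define l where "l = \<alpha> * eval_fps g \<rho> + \<beta> * eval_fps f \<rho>"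
  define K where "K = (\<bar>\<alpha>\<bar> + 1) * (\<bar>\<beta>\<bar> + 1)"
  have c_self: "(\<lambda>n. c n / c n) \<longlonglongrightarrow> 1"
    using c_shift_ratio [of 0] by simp
  have psum_lim: "psum f \<longlonglongrightarrow> eval_fps f \<rho>" "psum g \<longlonglongrightarrow> eval_fps g \<rho>"
     "psum C \<longlonglongrightarrow> eval_fps C \<rho>"
    unfolding psum_def by (rule asymp_partial_sums, fact f g c_self)+
  \<comment> \<open>This is the limit in n of the error bound \<open>u n\<close> below, for fixed L.
    It tends to 0 as L grows, so L can be chosen before n.\<close>
  define err where "err = (\<lambda>L. \<bar>\<alpha> * psum g L + \<beta> * psum f L - l\<bar>
    + K * (2 * eval_fps C \<rho> - 2 * psum C L))"
  have "err \<longlonglongrightarrow> \<bar>l - l\<bar> + K * (2 * eval_fps C \<rho> - 2 * eval_fps C \<rho>)"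
    unfolding err_def by (intro tendsto_intros psum_lim, unfold l_def, intro tendsto_intros psum_lim)
  then have "\<forall>\<^sub>F L in sequentially. err L < \<epsilon>"
    using \<open>\<epsilon> > 0\<close> by (intro order_tendstoD) auto
  moreover have "\<forall>\<^sub>F L in sequentially. \<forall>n\<ge>L.
      \<bar>fps_nth f n\<bar> \<le> (\<bar>\<alpha>\<bar> + 1) * c n \<and> \<bar>fps_nth g n\<bar> \<le> (\<bar>\<beta>\<bar> + 1) * c n"
    using asymp_bound [OF f] asymp_bound [OF g]
    by (intro eventually_all_ge_at_top eventually_conj)
  ultimately have "\<forall>\<^sub>F L in sequentially. err L < \<epsilon> \<and> (\<forall>n\<ge>L.
      \<bar>fps_nth f n\<bar> \<le> (\<bar>\<alpha>\<bar> + 1) * c n \<and> \<bar>fps_nth g n\<bar> \<le> (\<bar>\<beta>\<bar> + 1) * c n)"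
    by (rule eventually_conj)
  then obtain L where L: "err L < \<epsilon>"
    and fL: "\<And>n. n \<ge> L \<Longrightarrow> \<bar>fps_nth f n\<bar> \<le> (\<bar>\<alpha>\<bar> + 1) * c n"
    and gL: "\<And>n. n \<ge> L \<Longrightarrow> \<bar>fps_nth g n\<bar> \<le> (\<bar>\<beta>\<bar> + 1) * c n"
    unfolding eventually_sequentially by blast
  have head: "(\<lambda>n. (\<Sum>k<L. fps_nth p k * fps_nth q (n - k)) / c n) \<longlonglongrightarrow> \<gamma> * psum p L"
    if "(\<lambda>n. fps_nth q n / c n) \<longlonglongrightarrow> \<gamma>" for p q \<gamma>
  proof -
    have "(\<lambda>n. \<Sum>k<L. fps_nth p k * (fps_nth q (n - k) / c n))
        \<longlonglongrightarrow> (\<Sum>k<L. fps_nth p k * (\<gamma> * \<rho> ^ k))"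
      by (intro tendsto_intros asymp_shift that)
    then show ?thesis
      by (simp add: sum_divide_distrib sum_distrib_left psum_def mult_ac)
  qed
  define u where "u = (\<lambda>n. \<bar>(\<Sum>k<L. fps_nth f k * fps_nth g (n - k)) / c n
      + (\<Sum>k<L. fps_nth g k * fps_nth f (n - k)) / c n - l\<bar>
      + K * (fps_nth (C * C) n / c n - 2 * ((\<Sum>k<L. c k * c (n - k)) / c n)))"
  have "u \<longlonglongrightarrow> \<bar>\<beta> * psum f L + \<alpha> * psum g L - l\<bar> + K * (2 * eval_fps C \<rho> - 2 * (1 * psum C L))"
    unfolding u_def by (intro tendsto_intros head f g c_self c_convolution)
  then have "u \<longlonglongrightarrow> err L"
    by (simp add: err_def add.commute)
  then have "\<forall>\<^sub>F n in sequentially. u n < \<epsilon>"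
    using L by (rule order_tendstoD)
  then show "\<forall>\<^sub>F n in sequentially. dist (fps_nth (f * g) n / c n)
      (\<alpha> * eval_fps g \<rho> + \<beta> * eval_fps f \<rho>) < \<epsilon>"
    using c_eventually_pos eventually_ge_at_top [of "2 * L"]
  proof eventually_elim
    case (elim n)
    let ?mid = "\<Sum>k=L..n-L. fps_nth f k * fps_nth g (n - k)"
    have "\<bar>?mid\<bar> \<le> (\<Sum>k=L..n-L. \<bar>fps_nth f k * fps_nth g (n - k)\<bar>)"
      by (rule sum_abs)
    also have "\<dots> \<le> (\<Sum>k=L..n-L. K * (c k * c (n - k)))"
    proof (rule sum_mono)
      fix k assume "k \<in> {L..n-L}"
      then have "\<bar>fps_nth f k\<bar> * \<bar>fps_nth g (n - k)\<bar>
          \<le> ((\<bar>\<alpha>\<bar> + 1) * c k) * ((\<bar>\<beta>\<bar> + 1) * c (n - k))"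
        using elim by (intro mult_mono fL gL) (auto simp: c_nonneg)
      then show "\<bar>fps_nth f k * fps_nth g (n - k)\<bar> \<le> K * (c k * c (n - k))"
        by (simp add: abs_mult K_def mult_ac)
    qed
    also have "\<dots> = K * (fps_nth (C * C) n - 2 * (\<Sum>k<L. c k * c (n - k)))"
      using fps_mult_nth_split [OF elim(3), of C C] by (simp add: sum_distrib_left)
    finally have mid: "\<bar>?mid / c n\<bar> \<le> K * (fps_nth (C * C) n / c n - 2 * ((\<Sum>k<L. c k * c (n - k)) / c n))"
      using elim by (simp add: field_simps)
    have "fps_nth (f * g) n / c n - l = ((\<Sum>k<L. fps_nth f k * fps_nth g (n - k)) / c n
      + (\<Sum>k<L. fps_nth g k * fps_nth f (n - k)) / c n - l) + ?mid / c n"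
      using fps_mult_nth_split [OF elim(3), of f g] by (simp add: add_divide_distrib)
    then have "\<bar>fps_nth (f * g) n / c n - l\<bar> \<le> u n"
      using mid unfolding u_def by linarith
    then show ?case
      using elim by (simp add: dist_real_def l_def)
  qed
qed

end

subsection \<open>The exponential over all powers\<close>

text \<open>The recursion says Z' = Z S', so Z exp(-S) is constant on [0, 1] with value 1 at 0.
  Summability at some x > 1 places the point 1 inside both discs of convergence, where the series
  may be differentiated.\<close>

lemma suminf_exp_recursion:
  fixes z s :: "nat \<Rightarrow> real"
  assumes z_0: "z 0 = 1"
    and rec: "\<And>M. real M * z M = (\<Sum>i<M. z i * s (M - i))"
    and "x > 1" and z_sum: "summable (\<lambda>n. z n * x ^ n)" and s_sum: "summable (\<lambda>n. s n / real n * x ^ n)"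
  shows "suminf z = exp (\<Sum>j. s (Suc j) / real (Suc j))"
proof -
  define Z where "Z = Abs_fps z"
  \<comment> \<open>At n = 0 the quotient is 0 by the convention for division by zero, so S is the
    antiderivative without constant term.\<close>
  define S where "S = Abs_fps (\<lambda>n. s n / real n)"
  have "fps_deriv Z = Z * Abs_fps (\<lambda>j. s (Suc j))"
    unfolding fps_deriv_eq_mult_iff using rec by (simp add: Z_def)
  moreover have "fps_deriv S = Abs_fps (\<lambda>j. s (Suc j))"
    by (rule fps_ext) (simp add: S_def del: of_nat_Suc)
  ultimately have Z': "fps_deriv Z = Z * fps_deriv S" by simp
  have radius: "ereal x \<le> fps_conv_radius Z" "ereal x \<le> fps_conv_radius S"
    using conv_radius_geI [OF z_sum] conv_radius_geI [OF s_sum] \<open>x > 1\<close>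
    by (simp_all add: fps_conv_radius_def Z_def S_def)
  have inside: "ereal (norm y) < fps_conv_radius Z" "ereal (norm y) < fps_conv_radius S"
      "ereal (norm y) < fps_conv_radius (fps_deriv S)"
    if "y \<in> {0..1}" for y :: real
  proof -
    have "ereal (norm y) < ereal x" using that \<open>x > 1\<close> by simp
    also note radius(2)
    finally show S: "ereal (norm y) < fps_conv_radius S" .
    also note fps_conv_radius_deriv
    finally show "ereal (norm y) < fps_conv_radius (fps_deriv S)" .
    have "ereal (norm y) < ereal x" using that \<open>x > 1\<close> by simp
    also note radius(1)
    finally show "ereal (norm y) < fps_conv_radius Z" .
  qed
  define h where "h = (\<lambda>y. eval_fps Z y * exp (- eval_fps S y))"
  have h': "(h has_field_derivative 0) (at y)" if "y \<in> {0..1}" for y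
  proof -
    have "eval_fps (fps_deriv Z) y = eval_fps Z y * eval_fps (fps_deriv S) y"
      unfolding Z' by (rule eval_fps_mult) (use inside [OF that] in auto)
    then show ?thesis
      unfolding h_def using inside [OF that]
      by (auto intro!: derivative_eq_intros has_field_derivative_eval_fps)
  qed
  have "continuous_on {0..1} h"
    by (rule DERIV_continuous_on [OF has_field_derivative_at_within [OF h']])
  then have "h 1 = h 0"
    using h' by (intro DERIV_isconst2 [of 0 1 h 1]) auto
  moreover have "h 0 = 1"
    by (simp add: h_def eval_fps_at_0 Z_def S_def z_0)
  ultimately have "eval_fps Z 1 * exp (- eval_fps S 1) = 1"
    by (simp add: h_def)
  then have "eval_fps Z 1 = exp (eval_fps S 1)"
    by (simp add: exp_minus field_simps)
  moreover have "eval_fps Z 1 = suminf z"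
    by (simp add: eval_fps_def Z_def)
  moreover have "eval_fps S 1 = (\<Sum>j. s (Suc j) / real (Suc j))"
  proof -
    have "summable (\<lambda>n. fps_nth S n * 1 ^ n)"
      using inside [of 1] by (intro summable_fps) auto
    then show ?thesis
      using suminf_split_head [of "\<lambda>n. fps_nth S n * 1 ^ n"] by (simp add: eval_fps_def S_def)
  qed
  ultimately show ?thesis by simp
qed

text \<open>The finitely many exceptional indices are absorbed by adding up their quotients by w,
  which make sense because w is positive everywhere.\<close>

lemma bounded_multiple_from_eventually:
  fixes f w :: "nat \<Rightarrow> real"
  assumes "\<forall>\<^sub>F n in sequentially. f n \<le> K * w n" and w: "\<And>n. w n > 0"
  obtains K' where "K' > 0" "\<And>n. f n \<le> K' * w n"
proof -
  from assms(1) obtain N where N: "\<And>n. n \<ge> N \<Longrightarrow> f n \<le> K * w n"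
    unfolding eventually_sequentially by blast
  define K' where "K' = \<bar>K\<bar> + 1 + (\<Sum>k<N. \<bar>f k\<bar> / w k)"
  have sum_nonneg: "0 \<le> (\<Sum>k<N. \<bar>f k\<bar> / w k)"
    using w by (intro sum_nonneg) (simp add: less_imp_le)
  have "f n \<le> K' * w n" for n
  proof (cases "n < N")
    case True
    then have "\<bar>f n\<bar> / w n \<le> (\<Sum>k<N. \<bar>f k\<bar> / w k)"
      using w by (intro member_le_sum) (auto simp: less_imp_le)
    then have "\<bar>f n\<bar> / w n \<le> K'" by (simp add: K'_def)
    then show ?thesis using w [of n] by (simp add: field_simps)
  next
    case False
    then have "f n \<le> K * w n" using N by simp
    also have "\<dots> \<le> K' * w n"
      using sum_nonneg w [of n] by (intro mult_right_mono) (auto simp: K'_def)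
    finally show ?thesis .
  qed
  moreover have "K' > 0" using sum_nonneg by (simp add: K'_def)
  ultimately show ?thesis using that by blast
qed

section \<open>Exponential growth of \<open>c\<close> and positive weights\<close>

context subexponential_series
begin

text \<open>The quotients of consecutive terms tend to \<theta> * \<rho>, so the terms are even
  summable. Thus c_n outgrows every exponential of rate below 1 / \<rho>.\<close>

lemma power_over_c_tendsto_0:
  assumes "\<theta> > 0" "\<theta> * \<rho> < 1"
  shows "(\<lambda>n. \<theta> ^ n / c n) \<longlonglongrightarrow> 0"
proof -
  define r where "r = (\<theta> * \<rho> + 1) / 2"
  have "(\<lambda>n. \<theta> * (c n / c (Suc n))) \<longlonglongrightarrow> \<theta> * \<rho>"
    using c_ratio by (intro tendsto_intros) (subst (asm) filterlim_sequentially_Suc [symmetric], simp)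
  then have "\<forall>\<^sub>F n in sequentially. \<theta> * (c n / c (Suc n)) < r"
    by (rule order_tendstoD) (use assms in \<open>simp add: r_def mult.commute\<close>)
  with c_eventually_pos have "\<forall>\<^sub>F n in sequentially. c n > 0 \<and> \<theta> * (c n / c (Suc n)) < r"
    by (rule eventually_conj)
  then obtain N where N: "\<And>n. n \<ge> N \<Longrightarrow> c n > 0 \<and> \<theta> * (c n / c (Suc n)) < r"
    unfolding eventually_sequentially by blast
  have "summable (\<lambda>n. \<theta> ^ n / c n)"
  proof (rule summable_ratio_test)
    show "r < 1" using assms by (simp add: r_def)
    fix n assume n: "n \<ge> N"
    have "norm (\<theta> ^ Suc n / c (Suc n)) = \<theta> * (c n / c (Suc n)) * norm (\<theta> ^ n / c n)"
      using N [OF n] N [of "Suc n"] n assms by (simp add: abs_mult)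
    also have "\<dots> \<le> r * norm (\<theta> ^ n / c n)"
      using N [OF n] by (intro mult_right_mono) auto
    finally show "norm (\<theta> ^ Suc n / c (Suc n)) \<le> r * norm (\<theta> ^ n / c n)" .
  qed
  then show ?thesis by (rule summable_LIMSEQ_zero)
qed

text \<open>The finitely many zeros of \<open>c\<close> are filled in, so that the bounds below hold for all indices.\<close>

definition w :: "nat \<Rightarrow> real" where
  "w n = (if c n > 0 then c n else 1)"

lemma w_pos: "w n > 0"
  by (simp add: w_def)

lemma w_eventually_eq: "\<forall>\<^sub>F n in sequentially. w n = c n"
  using c_eventually_pos by eventually_elim (simp add: w_def)

lemma w_asymp: "(\<lambda>n. fps_nth (Abs_fps w) n / c n) \<longlonglongrightarrow> 1"
proof -
  have "\<forall>\<^sub>F n in sequentially. 1 = fps_nth (Abs_fps w) n / c n"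
    using c_eventually_pos by eventually_elim (simp add: w_def)
  then show ?thesis by (rule Lim_transform_eventually [OF tendsto_const])
qed

lemma asymp_bound_w:
  assumes "(\<lambda>n. fps_nth f n / c n) \<longlonglongrightarrow> \<alpha>"
  obtains K where "K > 0" "\<And>n. fps_nth f n \<le> K * w n"
proof -
  have "\<forall>\<^sub>F n in sequentially. fps_nth f n \<le> (\<bar>\<alpha>\<bar> + 1) * w n"
    using asymp_bound [OF assms] w_eventually_eq by eventually_elim simp
  then show ?thesis using w_pos bounded_multiple_from_eventually that by blast
qed

lemma w_convolution_bound:
  obtains K where "K > 0" "\<And>n. (\<Sum>i=0..n. w i * w (n - i)) \<le> K * w n"
  using asymp_bound_w [OF asymp_mult [OF w_asymp w_asymp]] by (auto simp: fps_mult_nth)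

text \<open>Powers of q between 0 and 4 serve as intermediate rates: \<open>q^(-2)\<close> shows
  that a fixed j \<ge> 2 is negligible, \<open>q^(-3)\<close> gives the bound uniform in j.\<close>

definition q :: real where "q = root 4 \<rho>"

lemma q_power_4: "q ^ 4 = \<rho>"
  using rho_pos by (simp add: q_def)

lemma q_pos: "q > 0" and q_less_1: "q < 1"
  using rho_pos rho_less_1 by (simp_all add: q_def)

lemma w_lower_bound:
  obtains K where "K > 0" "\<And>n. 1 \<le> K * w n * q ^ (3 * n)"
proof -
  have rho_eq: "\<rho> = q * q ^ 3"
    using q_power_4 by (simp flip: power_Suc)
  have "1 / q ^ 3 * \<rho> = 1 / q ^ 3 * (q * q ^ 3)"
    using rho_eq by (rule arg_cong)
  also have "\<dots> < 1"
    using q_pos q_less_1 by simp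
  finally have "1 / q ^ 3 * \<rho> < 1" .
  then have "(\<lambda>n. (1 / q ^ 3) ^ n / c n) \<longlonglongrightarrow> 0"
    using q_pos by (intro power_over_c_tendsto_0) auto
  then have "\<forall>\<^sub>F n in sequentially. (1 / q ^ 3) ^ n / c n < 1"
    by (rule order_tendstoD) simp
  then have "\<forall>\<^sub>F n in sequentially. (1 / q ^ 3) ^ n \<le> 1 * w n"
    using c_eventually_pos
  proof eventually_elim
    case (elim n)
    then have "(1 / q ^ 3) ^ n < c n"
      using divide_less_eq_1_pos by blast
    then show ?case using elim by (simp add: w_def)
  qed
  then obtain K where "K > 0" and K: "\<And>n. (1 / q ^ 3) ^ n \<le> K * w n"
    using w_pos bounded_multiple_from_eventually by blast
  have "1 \<le> K * w n * q ^ (3 * n)" for n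
    using K [of n] q_pos by (simp add: power_one_over field_simps flip: power_mult)
  with \<open>K > 0\<close> show ?thesis using that by blast
qed

end

text \<open>The coefficients of E are measured against \<open>c\<close>, so the convolution property
  stays that of the given series. In the application E is C / x^m without its constant term, and
  \<delta> is \<rho>^(-m).\<close>

locale subexponential_exp = subexponential_series +
  fixes E :: "real fps" and \<delta> :: real
  assumes E_0: "fps_nth E 0 = 0"
    and E_nonneg: "\<And>k. fps_nth E k \<ge> 0"
    and E_asymp: "(\<lambda>n. fps_nth E n / c n) \<longlonglongrightarrow> \<delta>"
begin

definition E_pow :: "nat \<Rightarrow> real fps" where
  "E_pow j = fps_compose E (fps_X ^ j)"

abbreviation P :: "nat \<Rightarrow> real fps" where
  "P \<equiv> fps_nth (G_series E)"

definition s :: "nat \<Rightarrow> real" where "s j = eval_fps (E_pow j) \<rho>"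

definition z :: "nat \<Rightarrow> real" where "z M = eval_fps (P M) \<rho>"

lemma E_pow_nth: "fps_nth (E_pow j) n = (if j dvd n then fps_nth E (n div j) else 0)"
  by (simp add: E_pow_def fps_nth_compose_X_power)

lemma E_pow_nonneg: "fps_nth (E_pow j) n \<ge> 0"
  by (simp add: E_pow_nth E_nonneg)

lemma P_recursion: "real M * fps_nth (P M) n = (\<Sum>i<M. fps_nth (P i * E_pow (M - i)) n)"
proof -
  have "fps_nth (of_nat M * P M) n = real M * fps_nth (P M) n"
    by (simp flip: fps_of_nat)
  then show ?thesis
    unfolding G_series_recursion by (simp add: fps_sum_nth E_pow_def)
qed

lemma P_nonneg: "fps_nth (P M) n \<ge> 0"
proof (induction M arbitrary: n rule: less_induct)
  case (less M)
  show ?case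
  proof (cases "M = 0")
    case False
    have "0 \<le> real M * fps_nth (P M) n"
      unfolding P_recursion fps_mult_nth
      using less by (intro sum_nonneg mult_nonneg_nonneg E_pow_nonneg) auto
    with False show ?thesis by (simp add: zero_le_mult_iff)
  qed simp
qed

lemma E_geometric_bound:
  obtains K where "K > 0" "\<And>k. fps_nth E k * q ^ (4 * k) \<le> K"
proof -
  have "(\<lambda>n. \<bar>fps_nth E n\<bar> * \<rho> ^ n) \<longlonglongrightarrow> 0"
    by (rule summable_LIMSEQ_zero [OF asymp_summable [OF E_asymp]])
  then have "Bseq (\<lambda>n. \<bar>fps_nth E n\<bar> * \<rho> ^ n)"
    by (rule convergent_imp_Bseq [OF convergentI])
  then obtain K where "K > 0" "\<And>n. norm (\<bar>fps_nth E n\<bar> * \<rho> ^ n) \<le> K"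
    unfolding Bseq_def by blast
  then show ?thesis
    using that [of K] rho_pos E_nonneg by (simp add: power_mult q_power_4)
qed

text \<open>For j \<ge> 2 the coefficient at n = jk is that of x^k in E, hence O(q^(-4k)), and 4k
  \<le> 2n. So it is O(q^(-2n)), which is negligible against c_n because \<rho> / q^2 = q^2 <
  1.\<close>

lemma E_pow_asymp:
  assumes "j \<ge> 1"
  shows "(\<lambda>n. fps_nth (E_pow j) n / c n) \<longlonglongrightarrow> (if j = 1 then \<delta> else 0)"
proof (cases "j = 1")
  case True
  then show ?thesis using E_asymp by (simp add: E_pow_nth)
next
  case False
  obtain K where "K > 0" and K: "\<And>k. fps_nth E k * q ^ (4 * k) \<le> K"
    using E_geometric_bound by blast
  have bound: "fps_nth (E_pow j) n \<le> K * (1 / q ^ 2) ^ n" for n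
  proof (cases "j dvd n")
    case True
    then obtain k where k: "n = j * k" by blast
    have "4 * k \<le> 2 * n" using k False assms by simp
    then have "q ^ (2 * n) \<le> q ^ (4 * k)"
      using q_pos q_less_1 by (intro power_decreasing) auto
    then have "fps_nth E k * q ^ (2 * n) \<le> fps_nth E k * q ^ (4 * k)"
      by (intro mult_left_mono E_nonneg)
    also note K
    finally show ?thesis
      using True assms k q_pos
      by (simp add: E_pow_nth power_one_over field_simps flip: power_mult)
  next
    case False
    then show ?thesis using \<open>K > 0\<close> q_pos by (simp add: E_pow_nth)
  qed
  have rho_eq: "\<rho> = q ^ 2 * q ^ 2"
    using q_power_4 by (metis numeral_Bit0 power_add)
  have "1 / q ^ 2 * \<rho> = 1 / q ^ 2 * (q ^ 2 * q ^ 2)"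
    using rho_eq by (rule arg_cong)
  also have "\<dots> < 1"
    using q_pos q_less_1 power_strict_decreasing [of 0 2 q] by simp
  finally have "1 / q ^ 2 * \<rho> < 1" .
  then have "(\<lambda>n. K * ((1 / q ^ 2) ^ n / c n)) \<longlonglongrightarrow> K * 0"
    using q_pos by (intro tendsto_intros power_over_c_tendsto_0) auto
  then have upper: "(\<lambda>n. K * ((1 / q ^ 2) ^ n / c n)) \<longlonglongrightarrow> 0"
    by simp
  have "(\<lambda>n. fps_nth (E_pow j) n / c n) \<longlonglongrightarrow> 0"
  proof (rule tendsto_sandwich [OF _ _ tendsto_const upper])
    show "\<forall>\<^sub>F n in sequentially. 0 \<le> fps_nth (E_pow j) n / c n"
      by (simp add: E_pow_nonneg c_nonneg)
    show "\<forall>\<^sub>F n in sequentially. fps_nth (E_pow j) n / c n \<le> K * ((1 / q ^ 2) ^ n / c n)"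
      using divide_right_mono [OF bound c_nonneg] by simp
  qed
  with False show ?thesis by simp
qed

text \<open>The two claims depend on each other: the recursion for z at M needs P_i with i < M to be
  absolutely summable at \<rho>, which follows from their asymptotics, while the asymptotics of P_M
  use the recursion at M - 1. The limit reflects that a single factor E(x) carries the large power
  of x and the remaining M - 1 powers of y are evaluated at \<rho>.\<close>

lemma P_asymp: "(\<lambda>n. fps_nth (P M) n / c n) \<longlonglongrightarrow> (if M = 0 then 0 else \<delta> * z (M - 1))"
  and z_recursion: "real M * z M = (\<Sum>i<M. z i * s (M - i))"
proof -
  define \<pi> where "\<pi> = (\<lambda>M. if M = 0 then 0 else \<delta> * z (M - 1))"
  have z_rec: "real M * z M = (\<Sum>i<M. z i * s (M - i))"
    if "\<And>i. i < M \<Longrightarrow> (\<lambda>n. fps_nth (P i) n / c n) \<longlonglongrightarrow> \<pi> i" for M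
  proof (cases "M = 0")
    case False
    have "(\<lambda>n. \<Sum>i<M. fps_nth (P i * E_pow (M - i)) n * \<rho> ^ n) sums (\<Sum>i<M. z i * s (M - i))"
      unfolding z_def s_def
      by (intro sums_sum sums_fps_mult)
        (use rho_pos in \<open>auto intro!: asymp_summable [OF that] asymp_summable [OF E_pow_asymp]\<close>)
    then have "(\<lambda>n. real M * (fps_nth (P M) n * \<rho> ^ n)) sums (\<Sum>i<M. z i * s (M - i))"
      unfolding mult.assoc [symmetric] P_recursion sum_distrib_right .
    then have "(\<lambda>n. fps_nth (P M) n * \<rho> ^ n) sums ((\<Sum>i<M. z i * s (M - i)) / real M)"
      using False by (intro sums_mult_D) auto
    then have "z M = (\<Sum>i<M. z i * s (M - i)) / real M"
      unfolding z_def eval_fps_def by (rule sums_unique [symmetric])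
    with False show ?thesis by (simp add: field_simps)
  qed simp
  have asymp: "(\<lambda>n. fps_nth (P M) n / c n) \<longlonglongrightarrow> \<pi> M" for M
  proof (induction M rule: less_induct)
    case (less M)
    show ?case
    proof (cases M)
      case 0
      have "\<forall>\<^sub>F n in sequentially. 0 = fps_nth (P 0) n / c n"
        using eventually_gt_at_top [of 0] by eventually_elim simp
      then show ?thesis
        using 0 by (auto simp: \<pi>_def intro: Lim_transform_eventually [OF tendsto_const])
    next
      case (Suc k)
      have "(\<lambda>n. \<Sum>i<M. fps_nth (P i * E_pow (M - i)) n / c n)
        \<longlonglongrightarrow> (\<Sum>i<M. \<pi> i * s (M - i) + (if M - i = 1 then \<delta> else 0) * z i)"
        unfolding s_def z_def by (intro tendsto_sum asymp_mult less E_pow_asymp) auto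
      \<comment> \<open>The second summand survives only at i = k, where E(x) itself occurs. In the
        first, \<pi> 0 = 0 and an index shift leaves \<delta> times the recursion for z at k; the
        total is \<delta> (k + 1) z k.\<close>
      also have "(\<Sum>i<M. \<pi> i * s (M - i) + (if M - i = 1 then \<delta> else 0) * z i)
          = (\<Sum>i<M. \<pi> i * s (M - i)) + \<delta> * z k"
        unfolding sum.distrib Suc by (simp add: less_Suc_eq Suc_diff_le)
      also have "(\<Sum>i<M. \<pi> i * s (M - i)) = \<delta> * (\<Sum>i<k. z i * s (k - i))"
        unfolding Suc sum.lessThan_Suc_shift by (simp add: \<pi>_def sum_distrib_left mult_ac)
      also have "\<dots> = \<delta> * (real k * z k)"
        using z_rec [of k] less Suc by simp
      finally have "(\<lambda>n. \<Sum>i<M. fps_nth (P i * E_pow (M - i)) n / c n) \<longlonglongrightarrow> real M * \<pi> M"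
        by (simp add: Suc \<pi>_def algebra_simps)
      moreover have "(\<Sum>i<M. fps_nth (P i * E_pow (M - i)) n / c n)
          = real M * (fps_nth (P M) n / c n)" for n
        using P_recursion [of M n] by (simp flip: sum_divide_distrib)
      ultimately show ?thesis
        using Suc tendsto_mult_left_iff [of "real M" "\<lambda>n. fps_nth (P M) n / c n" "\<pi> M"] by simp
    qed
  qed
  from asymp show "(\<lambda>n. fps_nth (P M) n / c n) \<longlonglongrightarrow> (if M = 0 then 0 else \<delta> * z (M - 1))"
    by (simp add: \<pi>_def)
  from z_rec asymp show "real M * z M = (\<Sum>i<M. z i * s (M - i))" by blast
qed

lemma E_pow_bound:
  obtains K where "K > 0" "\<And>j n. j \<ge> 1 \<Longrightarrow> fps_nth (E_pow j) n \<le> K * q ^ j * w n"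
proof -
  obtain K1 where "K1 > 0" and K1: "\<And>n. fps_nth E n \<le> K1 * w n"
    using asymp_bound_w [OF E_asymp] by blast
  obtain K2 where "K2 > 0" and K2: "\<And>k. fps_nth E k * q ^ (4 * k) \<le> K2"
    using E_geometric_bound by blast
  obtain K3 where "K3 > 0" and K3: "\<And>n. 1 \<le> K3 * w n * q ^ (3 * n)"
    using w_lower_bound by blast
  \<comment> \<open>The part K1 / q serves j = 1, where one power of q has to be given back; K2 * K3
    serves j \<ge> 2.\<close>
  define K where "K = K1 / q + K2 * K3"
  have "K > 0" using \<open>K1 > 0\<close> \<open>K2 > 0\<close> \<open>K3 > 0\<close> q_pos by (simp add: K_def add_pos_pos)
  moreover have "fps_nth (E_pow j) n \<le> K * q ^ j * w n" if "j \<ge> 1" for j n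
  proof (cases "j dvd n \<and> n \<noteq> 0")
    case False
    then have "fps_nth (E_pow j) n = 0" by (auto simp: E_pow_nth E_0)
    then show ?thesis using \<open>K > 0\<close> q_pos w_pos [of n] by simp
  next
    case True
    then obtain k where k: "n = j * k" "k \<ge> 1" by (metis dvdE less_one mult_0_right not_less)
    have E: "fps_nth (E_pow j) n = fps_nth E k"
      using that k by (simp add: E_pow_nth)
    show ?thesis
    proof (cases "j = 1")
      case True
      have "fps_nth E n \<le> K1 * w n" by (rule K1)
      also have "\<dots> \<le> K * q ^ j * w n"
        using \<open>K2 > 0\<close> \<open>K3 > 0\<close> q_pos w_pos [of n] True
        by (intro mult_right_mono) (auto simp: K_def algebra_simps)
      finally show ?thesis using True by (simp add: E_pow_nth)
    next
      case False
      \<comment> \<open>With n = jk, j \<ge> 2 gives 4k \<le> 2n and k \<ge> 1 gives j \<le> n. The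
        first part pays for the growth of E, the second yields the decay in j.\<close>
      have "2 * k \<le> j * k" using False that by (intro mult_right_mono) auto
      moreover have "j \<le> j * k" using k by simp
      ultimately have "4 * k + j \<le> 3 * n"
        using k(1) by linarith
      then have "q ^ (3 * n) \<le> q ^ (4 * k + j)"
        using q_pos q_less_1 by (intro power_decreasing) auto
      then have "K3 * w n * q ^ (3 * n) \<le> K3 * w n * q ^ (4 * k + j)"
        using \<open>K3 > 0\<close> w_pos [of n] by (intro mult_left_mono) auto
      with K3 [of n] have "1 \<le> K3 * w n * q ^ (4 * k + j)" by linarith
      then have "fps_nth E k * 1 \<le> fps_nth E k * (K3 * w n * q ^ (4 * k + j))"
        by (intro mult_left_mono E_nonneg)
      also have "\<dots> = (fps_nth E k * q ^ (4 * k)) * (K3 * w n * q ^ j)"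
        by (simp add: power_add mult_ac)
      also have "\<dots> \<le> K2 * (K3 * w n * q ^ j)"
        using K2 \<open>K3 > 0\<close> w_pos [of n] q_pos by (intro mult_right_mono) auto
      also have "\<dots> = (K2 * K3) * (q ^ j * w n)" by simp
      also have "\<dots> \<le> K * (q ^ j * w n)"
        using \<open>K1 > 0\<close> q_pos w_pos [of n] by (intro mult_right_mono) (auto simp: K_def)
      finally show ?thesis using E by (simp add: mult_ac)
    qed
  qed
  ultimately show ?thesis using that by blast
qed

text \<open>The recursion of (1 - qy)^(-\<kappa>) has \<kappa> q^j in the place of E(x^j). Each
  product in the recursion for P costs K1 from E(x^j) and K2 from convolving the weights; \<kappa> =
  K1 * K2 absorbs both, so K stays the same throughout the induction.\<close>

lemma P_bound:
  obtains K \<kappa> where "K > 0" "\<kappa> > 0"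
    "\<And>M n. fps_nth (P M) n \<le> K * (q ^ M * rising \<kappa> M) * w n"
proof -
  obtain K1 where "K1 > 0" and K1: "\<And>j n. j \<ge> 1 \<Longrightarrow> fps_nth (E_pow j) n \<le> K1 * q ^ j * w n"
    using E_pow_bound by blast
  obtain K2 where "K2 > 0" and K2: "\<And>n. (\<Sum>i=0..n. w i * w (n - i)) \<le> K2 * w n"
    using w_convolution_bound by blast
  \<comment> \<open>Chosen for the base case: P_0 = 1 has the single nonzero coefficient 1, at n =
    0.\<close>
  define K where "K = 1 / w 0"
  define \<kappa> where "\<kappa> = K1 * K2"
  have "K > 0" "\<kappa> > 0" using w_pos \<open>K1 > 0\<close> \<open>K2 > 0\<close> by (simp_all add: K_def \<kappa>_def)
  have "fps_nth (P M) n \<le> K * (q ^ M * rising \<kappa> M) * w n" for M n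
  proof (induction M arbitrary: n rule: less_induct)
    case (less M)
    show ?case
    proof (cases "M = 0")
      case True
      then show ?thesis using w_pos [of 0] w_pos [of n] by (simp add: K_def)
    next
      case False
      have term_bound: "fps_nth (P i * E_pow (M - i)) n \<le> (K * q ^ M * w n) * (rising \<kappa> i * \<kappa>)"
        if "i < M" for i
      proof -
        have "fps_nth (P i * E_pow (M - i)) n
            \<le> (\<Sum>k=0..n. (K * (q ^ i * rising \<kappa> i) * w k) * (K1 * q ^ (M - i) * w (n - k)))"
          unfolding fps_mult_nth using that \<open>K > 0\<close> q_pos w_pos rising_pos [OF \<open>\<kappa> > 0\<close>]
          by (intro sum_mono mult_mono less K1 E_pow_nonneg) (auto simp: less_imp_le)
        also have "\<dots> = (K * rising \<kappa> i * K1 * (q ^ i * q ^ (M - i))) * (\<Sum>k=0..n. w k * w (n - k))"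
          by (simp add: sum_distrib_left mult_ac)
        also have "\<dots> \<le> (K * rising \<kappa> i * K1 * (q ^ i * q ^ (M - i))) * (K2 * w n)"
          using K2 \<open>K > 0\<close> \<open>K1 > 0\<close> q_pos rising_pos [OF \<open>\<kappa> > 0\<close>, of i] by (intro mult_left_mono) auto
        also have "q ^ i * q ^ (M - i) = q ^ M"
          using that by (simp flip: power_add)
        finally show ?thesis by (simp add: \<kappa>_def mult_ac)
      qed
      have "real M * fps_nth (P M) n \<le> (\<Sum>i<M. (K * q ^ M * w n) * (rising \<kappa> i * \<kappa>))"
        unfolding P_recursion using term_bound by (intro sum_mono) auto
      also have "\<dots> = real M * (K * (q ^ M * rising \<kappa> M) * w n)"
        unfolding sum_distrib_left [symmetric] rising_recursion [symmetric] by simp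
      finally show ?thesis using False by simp
    qed
  qed
  with \<open>K > 0\<close> \<open>\<kappa> > 0\<close> show ?thesis using that by blast
qed

lemma s_eq: "j \<ge> 1 \<Longrightarrow> s j = eval_fps E (\<rho> ^ j)"
proof -
  assume j: "j \<ge> 1"
  have "(\<Sum>n. fps_nth (E_pow j) (j * n) * \<rho> ^ (j * n)) = (\<Sum>n. fps_nth (E_pow j) n * \<rho> ^ n)"
    using j by (intro suminf_mono_reindex [of "\<lambda>n. j * n"]) (auto simp: strict_mono_def E_pow_nth)
  then show ?thesis
    using j by (simp add: s_def eval_fps_def E_pow_nth power_mult)
qed

lemma w_summable: "summable (\<lambda>n. w n * \<rho> ^ n)"
  using asymp_summable [OF w_asymp] w_pos by (simp add: less_imp_le)

lemma eval_fps_le_w: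
  assumes "\<And>n. 0 \<le> fps_nth f n" "\<And>n. fps_nth f n \<le> K * w n"
  shows "0 \<le> eval_fps f \<rho>" "eval_fps f \<rho> \<le> K * (\<Sum>n. w n * \<rho> ^ n)"
proof -
  have le: "fps_nth f n * \<rho> ^ n \<le> K * (w n * \<rho> ^ n)" for n
    using mult_right_mono [OF assms(2) [of n], of "\<rho> ^ n"] rho_pos by (simp add: mult_ac)
  have sum: "summable (\<lambda>n. fps_nth f n * \<rho> ^ n)"
    by (rule summable_comparison_test' [OF summable_mult [OF w_summable]])
      (use le assms(1) rho_pos in auto)
  show "0 \<le> eval_fps f \<rho>"
    unfolding eval_fps_def using sum assms(1) rho_pos by (intro suminf_nonneg) auto
  show "eval_fps f \<rho> \<le> K * (\<Sum>n. w n * \<rho> ^ n)"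
    unfolding eval_fps_def suminf_mult [OF w_summable, symmetric]
    by (intro suminf_le le sum summable_mult w_summable)
qed

text \<open>Evaluating the coefficient bounds at \<rho> gives decay q^j for s, and q^M up to
  polynomial growth for z. Both power series therefore converge beyond 1, as
  \<open>suminf_exp_recursion\<close> demands.\<close>

lemma s_summable: "summable (\<lambda>j. s (Suc j) / real (Suc j))"
  and suminf_z: "summable z" "suminf z = exp (\<Sum>j. s (Suc j) / real (Suc j))"
proof -
  define W where "W = (\<Sum>n. w n * \<rho> ^ n)"
  \<comment> \<open>Any x with 1 < x < 1 / q would do; here q * x = 2q / (1 + q).\<close>
  define x where "x = 2 / (1 + q)"
  have x: "x > 1" "q * x < 1" using q_pos q_less_1 by (auto simp: x_def field_simps)
  obtain K1 where "K1 > 0" and K1: "\<And>j n. j \<ge> 1 \<Longrightarrow> fps_nth (E_pow j) n \<le> K1 * q ^ j * w n"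
    using E_pow_bound by blast
  have s_bound: "0 \<le> s j" "s j \<le> K1 * q ^ j * W" if "j \<ge> 1" for j
    using eval_fps_le_w [OF E_pow_nonneg K1] that by (auto simp: s_def W_def)
  obtain K2 \<kappa> where "K2 > 0" "\<kappa> > 0" and K2: "\<And>M n. fps_nth (P M) n \<le> K2 * (q ^ M * rising \<kappa> M) * w n"
    using P_bound by blast
  have z_bound: "0 \<le> z M" "z M \<le> K2 * (q ^ M * rising \<kappa> M) * W" for M
    using eval_fps_le_w [OF P_nonneg K2] by (auto simp: z_def W_def)
  have s_sum: "summable (\<lambda>n. s n / real n * x ^ n)"
  proof (rule summable_comparison_test' [where N = 1])
    show "summable (\<lambda>n. K1 * W * (q * x) ^ n)"
      using x q_pos by (intro summable_mult summable_geometric) auto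
    show "norm (s n / real n * x ^ n) \<le> K1 * W * (q * x) ^ n" if "n \<ge> 1" for n
    proof -
      have "s n / real n \<le> s n / 1"
        using s_bound(1) [OF that] that by (intro divide_left_mono) auto
      also have "\<dots> \<le> K1 * q ^ n * W" using s_bound(2) [OF that] by simp
      finally have "s n / real n * x ^ n \<le> K1 * q ^ n * W * x ^ n"
        using x by (intro mult_right_mono) auto
      then show ?thesis
        using s_bound(1) [OF that] x by (simp add: power_mult_distrib mult_ac)
    qed
  qed
  have z_sum: "summable (\<lambda>n. z n * x ^ n)"
  proof (rule summable_comparison_test')
    show "summable (\<lambda>n. K2 * W * (real (Suc n) * ((q * x) ^ n * rising \<kappa> n)))"
      using x q_pos \<open>\<kappa> > 0\<close> by (intro summable_mult summable_linear_power_rising) auto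
    show "norm (z n * x ^ n) \<le> K2 * W * (real (Suc n) * ((q * x) ^ n * rising \<kappa> n))" if "n \<ge> 0" for n
    proof -
      let ?b = "K2 * (q ^ n * rising \<kappa> n) * W * x ^ n"
      have le: "z n * x ^ n \<le> ?b"
        using x by (intro mult_right_mono z_bound) auto
      moreover have "0 \<le> z n * x ^ n" using z_bound x by simp
      ultimately have "0 \<le> ?b" by linarith
      then have "1 * ?b \<le> real (Suc n) * ?b" by (intro mult_right_mono) auto
      with le \<open>0 \<le> z n * x ^ n\<close> show ?thesis
        by (simp add: power_mult_distrib mult_ac)
    qed
  qed
  have "z 0 = 1"
    by (simp add: z_def)
  then show "suminf z = exp (\<Sum>j. s (Suc j) / real (Suc j))"
    using suminf_exp_recursion [OF _ z_recursion x(1) z_sum s_sum] by simp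
  have "summable (\<lambda>n. s n / real n * 1 ^ n)"
    using powser_inside [OF s_sum, of 1] x by simp
  then have "summable (\<lambda>n. s n / real n)" by simp
  then show "summable (\<lambda>j. s (Suc j) / real (Suc j))"
    by (subst summable_Suc_iff)
  have "summable (\<lambda>n. z n * 1 ^ n)"
    using powser_inside [OF z_sum, of 1] x by simp
  then show "summable z" by simp
qed

text \<open>The quotient of \<open>rising\<close> costs a factor linear in M, and
  \<open>P_bound\<close> supplies a summable one, both independent of i. The limit series has no
  term at M = 0, as P_0 = 1 contributes nothing for large r, so it is \<delta> times the sum of
  z.\<close>

lemma rising_convolution_asymp:
  fixes r N :: "nat \<Rightarrow> nat"
  assumes "a > 0" and r: "filterlim r at_top sequentially" and N: "filterlim N at_top sequentially"
  shows "(\<lambda>i. (\<Sum>M\<le>N i. rising a (N i - M) * fps_nth (P M) (r i)) / (rising a (N i) * c (r i)))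
    \<longlonglongrightarrow> \<delta> * exp (\<Sum>j. s (Suc j) / real (Suc j))"
proof -
  obtain K \<kappa> where "K > 0" "\<kappa> > 0"
    and K: "\<And>M n. fps_nth (P M) n \<le> K * (q ^ M * rising \<kappa> M) * w n"
    using P_bound by blast
  \<comment> \<open>Extension by 0 beyond N i turns a sum of varying length into a series over all
    M.\<close>
  define t where "t = (\<lambda>M i. if M \<le> N i
    then rising a (N i - M) / rising a (N i) * (fps_nth (P M) (r i) / c (r i)) else 0)"
  define b where "b = (\<lambda>M. (1 + 1 / a) * K * (real (Suc M) * (q ^ M * rising \<kappa> M)))"
  have ratio_le: "rising a (n - M) / rising a n \<le> (1 + 1 / a) * real (Suc M)" if "M \<le> n" for n M
  proof (cases "M = 0")
    case False
    then have "rising a (n - M) \<le> (1 + 1 / a) * real M * rising a n"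
      using rising_le [OF \<open>a > 0\<close>, of M "n - M"] that by simp
    also have "\<dots> \<le> (1 + 1 / a) * real (Suc M) * rising a n"
      using \<open>a > 0\<close> rising_pos [OF \<open>a > 0\<close>, of n] by (intro mult_right_mono mult_left_mono) auto
    finally show ?thesis
      using rising_pos [OF \<open>a > 0\<close>, of n] by (simp add: field_simps)
  qed (use \<open>a > 0\<close> in simp)
  have lim: "t M \<longlonglongrightarrow> (if M = 0 then 0 else \<delta> * z (M - 1))" for M
  proof -
    have "(\<lambda>i. rising a (N i - M) / rising a (N i) * (fps_nth (P M) (r i) / c (r i)))
        \<longlonglongrightarrow> 1 * (if M = 0 then 0 else \<delta> * z (M - 1))"
      by (intro tendsto_mult filterlim_compose [OF rising_diff_ratio [OF \<open>a > 0\<close>] N]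
          filterlim_compose [OF P_asymp r])
    moreover have "\<forall>\<^sub>F i in sequentially.
       rising a (N i - M) / rising a (N i) * (fps_nth (P M) (r i) / c (r i)) = t M i"
      using eventually_compose_filterlim [OF eventually_ge_at_top [of M] N]
      by eventually_elim (simp add: t_def)
    ultimately show ?thesis
      by (simp only: mult_1) (rule Lim_transform_eventually)
  qed
  have "\<forall>\<^sub>F i in sequentially. \<forall>M. norm (t M i) \<le> b M"
    using eventually_compose_filterlim [OF c_eventually_pos r]
  proof eventually_elim
    case (elim i)
    show ?case
    proof
      fix M
      have "0 \<le> b M"
        using \<open>a > 0\<close> \<open>K > 0\<close> q_pos rising_pos [OF \<open>\<kappa> > 0\<close>, of M] by (simp add: b_def)
      moreover have "norm (t M i) \<le> b M" if "M \<le> N i"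
      proof -
        \<comment> \<open>Since c (r i) > 0, the weight w (r i) is c (r i). How large i must be for
          this does not depend on M, as domination requires.\<close>
        have "fps_nth (P M) (r i) / c (r i) \<le> K * (q ^ M * rising \<kappa> M)"
          using K [of M "r i"] elim by (simp add: w_def field_simps)
        then have "rising a (N i - M) / rising a (N i) * (fps_nth (P M) (r i) / c (r i))
            \<le> (1 + 1 / a) * real (Suc M) * (K * (q ^ M * rising \<kappa> M))"
          using \<open>a > 0\<close> P_nonneg elim by (intro mult_mono ratio_le that) auto
        moreover have "0 \<le> rising a (N i - M) / rising a (N i) * (fps_nth (P M) (r i) / c (r i))"
          using P_nonneg elim rising_pos [OF \<open>a > 0\<close>] by (simp add: less_imp_le)
        ultimately show ?thesis
          using that by (simp add: t_def b_def mult_ac)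
      qed
      ultimately show "norm (t M i) \<le> b M" by (cases "M \<le> N i") (auto simp: t_def)
    qed
  qed
  then have "\<forall>\<^sub>F (M :: nat, i) in at_top \<times>\<^sub>F sequentially. \<forall>M. norm (t M i) \<le> b M"
    by (subst eventually_prod2) auto
  then have bound: "\<forall>\<^sub>F (M, i) in at_top \<times>\<^sub>F sequentially. norm (t M i) \<le> b M"
    by (rule eventually_mono) auto
  have "summable b"
    unfolding b_def using \<open>\<kappa> > 0\<close> q_pos q_less_1
    by (intro summable_mult summable_linear_power_rising) auto
  from tannerys_theorem [OF lim bound this]
  have "(\<lambda>i. \<Sum>M. t M i) \<longlonglongrightarrow> (\<Sum>M. if M = 0 then 0 else \<delta> * z (M - 1))"
    by simp
  also have "(\<Sum>M. if M = 0 then 0 else \<delta> * z (M - 1)) = \<delta> * suminf z"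
  proof -
    have "(\<lambda>M. \<delta> * z M) sums (\<delta> * suminf z)"
      using suminf_z(1) by (intro sums_mult summable_sums)
    then have "(\<lambda>M. if M = 0 then 0 else \<delta> * z (M - 1)) sums (\<delta> * suminf z)"
      using sums_Suc [of "\<lambda>M. if M = 0 then 0 else \<delta> * z (M - 1)" "\<delta> * suminf z"] by simp
    then show ?thesis by (rule sums_unique [symmetric])
  qed
  also have "(\<lambda>i. \<Sum>M. t M i) = (\<lambda>i. (\<Sum>M\<le>N i. rising a (N i - M) * fps_nth (P M) (r i))
      / (rising a (N i) * c (r i)))"
  proof
    fix i
    have "(\<Sum>M. t M i) = (\<Sum>M\<le>N i. t M i)"
      by (rule suminf_finite) (auto simp: t_def)
    also have "\<dots> = (\<Sum>M\<le>N i. rising a (N i - M) * fps_nth (P M) (r i) / (rising a (N i) * c (r i)))"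
      by (intro sum.cong) (auto simp: t_def)
    finally show "(\<Sum>M. t M i) = (\<Sum>M\<le>N i. rising a (N i - M) * fps_nth (P M) (r i))
      / (rising a (N i) * c (r i))"
      by (simp add: sum_divide_distrib)
  qed
  finally show ?thesis by (simp add: suminf_z(2))
qed

end

subsection \<open>Splitting off the lowest term\<close>

definition tail_series :: "nat \<Rightarrow> real fps \<Rightarrow> real fps" where
  "tail_series m C = Abs_fps (\<lambda>n. if n = 0 then 0 else fps_nth C (n + m))"

lemma fps_eq_X_power_mult_tail_series:
  assumes "\<And>k. k < m \<Longrightarrow> fps_nth C k = 0"
  shows "C = fps_X ^ m * (fps_const (fps_nth C m) + tail_series m C)"
  by (rule fps_ext) (auto simp: fps_X_power_mult_nth tail_series_def assms)

lemma fps_compose_X_power_tail_series: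
  assumes "\<And>k. k < m \<Longrightarrow> fps_nth C k = 0" "j \<ge> 1"
  shows "fps_compose C (fps_X ^ j) =
    fps_X ^ (m * j) * (fps_const (fps_nth C m) + fps_compose (tail_series m C) (fps_X ^ j))"
proof -
  have X0: "fps_nth (fps_X ^ j) 0 = (0 :: real)"
    using assms(2) by simp
  have "fps_compose C (fps_X ^ j)
      = fps_compose (fps_X ^ m * (fps_const (fps_nth C m) + tail_series m C)) (fps_X ^ j)"
    using fps_eq_X_power_mult_tail_series [OF assms(1)] by (rule arg_cong)
  also have "\<dots> = fps_compose (fps_X ^ m) (fps_X ^ j)
      * (fps_const (fps_nth C m) + fps_compose (tail_series m C) (fps_X ^ j))"
    by (simp add: fps_compose_mult_distrib [OF X0] fps_compose_add_distrib)
  also have "fps_compose (fps_X ^ m) (fps_X ^ j) = (fps_X ^ (m * j) :: real fps)"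
    using X0 by (simp add: fps_X_power_compose power_mult mult.commute)
  finally show ?thesis .
qed

text \<open>With \<open>C = x^m (a + E)\<close>, substituting \<open>y x^(-m)\<close> for \<open>y\<close> turns \<open>G\<close> into
  \<open>(1 - y)^(-a)\<close> times the series \<open>G\<close> of \<open>E\<close>.\<close>

lemma G_series_factorization:
  assumes "\<And>k. k < m \<Longrightarrow> fps_nth C k = 0"
  shows "fps_nth (G_series C) N = fps_X ^ (m * N) *
    (\<Sum>M\<le>N. fps_const (rising (fps_nth C m) (N - M)) * fps_nth (G_series (tail_series m C)) M)"
proof -
  define a where "a = fps_nth C m"
  define E where "E = tail_series m C"
  define R where "R = Abs_fps (\<lambda>k. fps_const (rising a k))"
  \<comment> \<open>Logarithmic derivatives of a product add, so H belongs to the exponent with a +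
    E(x^j) = C(x^j) / x^(jm).\<close>
  define H where "H = G_series E * R"
  define S where "S = (\<lambda>j. fps_const a + fps_compose E (fps_X ^ j))"
  have "fps_deriv R = R * Abs_fps (\<lambda>j. fps_const a)"
    unfolding fps_deriv_eq_mult_iff [where S = "\<lambda>_. fps_const a"]
  proof
    fix M
    have "of_nat M * fps_nth R M = fps_const (real M * rising a M)"
      by (simp add: R_def flip: fps_of_nat)
    also have "\<dots> = (\<Sum>i<M. fps_nth R i * fps_const a)"
      by (rule fps_ext) (simp add: rising_recursion R_def fps_sum_nth)
    finally show "of_nat M * fps_nth R M = (\<Sum>i<M. fps_nth R i * fps_const a)" .
  qed
  moreover have "Abs_fps (\<lambda>j. S (Suc j))
      = Abs_fps (\<lambda>j. fps_const a) + Abs_fps (\<lambda>j. fps_compose E (fps_X ^ Suc j))"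
    by (rule fps_ext) (simp add: S_def)
  ultimately have "fps_deriv H = H * Abs_fps (\<lambda>j. S (Suc j))"
    by (simp add: H_def fps_deriv_G_series distrib_left mult_ac)
  then have H_rec: "of_nat M * fps_nth H M = (\<Sum>i<M. fps_nth H i * S (M - i))" for M
    unfolding fps_deriv_eq_mult_iff by blast
  \<comment> \<open>This is the substitution of y x^m for y in H, made coefficientwise so that no
    negative power of x occurs. Uniqueness then identifies the result with
    \<open>G_series C\<close>.\<close>
  define G where "G = Abs_fps (\<lambda>N. fps_X ^ (m * N) * fps_nth H N)"
  have "fps_deriv G = G * Abs_fps (\<lambda>j. fps_compose C (fps_X ^ Suc j))"
    unfolding fps_deriv_eq_mult_iff [where S = "\<lambda>j. fps_compose C (fps_X ^ j)"]
  proof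
    fix M
    have "fps_nth G i * fps_compose C (fps_X ^ (M - i)) = fps_X ^ (m * M) * (fps_nth H i * S (M - i))"
      if "i < M" for i
    proof -
      have "fps_compose C (fps_X ^ (M - i)) = fps_X ^ (m * (M - i)) * S (M - i)"
        unfolding S_def a_def E_def using that
        by (intro fps_compose_X_power_tail_series assms) auto
      moreover have "fps_X ^ (m * M) = fps_X ^ (m * i) * (fps_X ^ (m * (M - i)) :: real fps)"
        using that by (simp flip: power_add distrib_left)
      ultimately show ?thesis by (simp add: G_def mult_ac)
    qed
    then have "(\<Sum>i<M. fps_nth G i * fps_compose C (fps_X ^ (M - i)))
        = (\<Sum>i<M. fps_X ^ (m * M) * (fps_nth H i * S (M - i)))"
      by (intro sum.cong) auto
    also have "\<dots> = fps_X ^ (m * M) * (of_nat M * fps_nth H M)"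
      unfolding H_rec by (simp add: sum_distrib_left)
    finally show "of_nat M * fps_nth G M = (\<Sum>i<M. fps_nth G i * fps_compose C (fps_X ^ (M - i)))"
      by (simp add: G_def mult_ac)
  qed
  moreover have "fps_nth G 0 = fps_nth (G_series C) 0"
    by (simp add: G_def H_def R_def)
  ultimately have "G = G_series C"
    using fps_deriv_eq_mult_unique [where S = "\<lambda>j. fps_compose C (fps_X ^ j)"] fps_deriv_G_series
    by blast
  then have "fps_nth (G_series C) N = fps_X ^ (m * N) * fps_nth H N"
    by (simp add: G_def flip: \<open>G = G_series C\<close>)
  then show ?thesis
    by (simp add: H_def fps_mult_nth R_def a_def E_def atMost_atLeast0 mult.commute)
qed

text \<open>At x = \<rho>^j this turns the numerator of \<open>A_term\<close> into \<rho>^(jm)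
  E(\<rho>^j), so the exponent in \<open>A_const\<close> becomes the one in the sum of z. Of the m +
  1 initial terms removed only the last is nonzero.\<close>

lemma eval_fps_tail_series:
  assumes "\<And>k. k < m \<Longrightarrow> fps_nth C k = 0" "summable (\<lambda>n. fps_nth C n * x ^ n)" "x \<noteq> 0"
  shows "eval_fps C x - fps_nth C m * x ^ m = x ^ m * eval_fps (tail_series m C) x"
proof -
  have "(\<lambda>n. fps_nth C n * x ^ n) sums eval_fps C x"
    unfolding eval_fps_def using assms(2) by (rule summable_sums)
  then have "(\<lambda>n. fps_nth C (n + Suc m) * x ^ (n + Suc m))
      sums (eval_fps C x - (\<Sum>i<Suc m. fps_nth C i * x ^ i))"
    by (rule sums_split_initial_segment)
  also have "(\<Sum>i<Suc m. fps_nth C i * x ^ i) = fps_nth C m * x ^ m"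
    using assms(1) by simp
  also have "(\<lambda>n. fps_nth C (n + Suc m) * x ^ (n + Suc m))
      = (\<lambda>n. x ^ m * (fps_nth (tail_series m C) (Suc n) * x ^ Suc n))"
    by (simp add: tail_series_def power_add mult_ac)
  finally have "(\<lambda>n. x ^ m * (fps_nth (tail_series m C) (Suc n) * x ^ Suc n))
      sums (eval_fps C x - fps_nth C m * x ^ m)" .
  from sums_mult_D [OF this]
  have "(\<lambda>n. fps_nth (tail_series m C) (Suc n) * x ^ Suc n)
      sums ((eval_fps C x - fps_nth C m * x ^ m) / x ^ m)"
    using assms(3) by simp
  then have "(\<lambda>n. fps_nth (tail_series m C) n * x ^ n)
      sums ((eval_fps C x - fps_nth C m * x ^ m) / x ^ m)"
    using sums_Suc [of "\<lambda>n. fps_nth (tail_series m C) n * x ^ n"] by (simp add: tail_series_def)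
  then have "eval_fps (tail_series m C) x = (eval_fps C x - fps_nth C m * x ^ m) / x ^ m"
    unfolding eval_fps_def by (rule sums_unique [symmetric])
  then show ?thesis using assms(3) by simp
qed

section \<open>Assembly of the asymptotics\<close>

theorem theorem1p1:
  fixes c :: "nat \<Rightarrow> real" and C :: "real fps" and \<rho> :: real and m :: nat
  assumes "c 0 = 0"
    and "\<And>k. c k \<ge> 0"
    and "C = Abs_fps c"
    and "subexponential C \<rho>"
    and "0 < \<rho>" and "\<rho> < 1"
    and "m = (LEAST k. k \<ge> 1 \<and> c k > 0)"
  shows "summable (\<lambda>j. A_term C \<rho> m (Suc j)) \<and>
    (\<forall>n N :: nat \<Rightarrow> nat.
      (\<forall>i. n i \<ge> 1 \<and> N i \<ge> 1) \<longrightarrow>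
      filterlim n at_top sequentially \<longrightarrow>
      filterlim N at_top sequentially \<longrightarrow>
      filterlim (\<lambda>i. int (n i) - int m * int (N i)) at_top sequentially \<longrightarrow>
      (\<lambda>i. coeff_xy (G_series C) (n i) (N i) /
            (A_const C \<rho> m * real (N i) powr (c m - 1) * c (n i - m * (N i - 1))))
        \<longlonglongrightarrow> 1)"
proof -
  have C_nth: "fps_nth C k = c k" for k
    using assms(3) by simp
  interpret C: subexponential_series C \<rho>
    by unfold_locales fact+
  define a where "a = c m"
  obtain k where "k \<ge> 1" "c k > 0"
    using eventually_conj [OF C.c_eventually_pos eventually_ge_at_top [of 1]]
    unfolding eventually_sequentially C_nth by blast
  then have "c m > 0"
    unfolding assms(7) using LeastI [of "\<lambda>k. k \<ge> 1 \<and> c k > 0" k] by simp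
  then have "a > 0" by (simp add: a_def)
  have low: "fps_nth C k = 0" if "k < m" for k
  proof (cases "k = 0")
    case False
    with that have "\<not> (k \<ge> 1 \<and> c k > 0)"
      unfolding assms(7) by (intro not_less_Least)
    with False assms(2) [of k] show ?thesis by (simp add: C_nth)
  qed (simp add: C_nth assms(1))
  define E where "E = tail_series m C"
  interpret subexponential_exp C \<rho> E "1 / \<rho> ^ m"
  proof unfold_locales
    show "fps_nth E 0 = 0" "fps_nth E k \<ge> 0" for k
      by (simp_all add: E_def tail_series_def C.c_nonneg)
    have "\<forall>\<^sub>F n in sequentially. fps_nth C (n + m) / fps_nth C n = fps_nth E n / fps_nth C n"
      using eventually_gt_at_top [of 0] by eventually_elim (simp add: E_def tail_series_def)
    with C.c_add_ratio show "(\<lambda>n. fps_nth E n / fps_nth C n) \<longlonglongrightarrow> 1 / \<rho> ^ m"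
      by (rule Lim_transform_eventually)
  qed
  have factor: "fps_nth (G_series C) M = fps_X ^ (m * M) *
      (\<Sum>i\<le>M. fps_const (rising a (M - i)) * P i)" for M
    unfolding E_def using G_series_factorization [of m C M] low by (simp add: C_nth a_def)
  define B where "B = exp (\<Sum>j. s (Suc j) / real (Suc j))"
  have A_term: "A_term C \<rho> m (Suc j) = s (Suc j) / real (Suc j)" for j
  proof -
    have "summable (\<lambda>n. fps_nth C n * (\<rho> ^ Suc j) ^ n)"
    proof (rule summable_comparison_test' [OF C.c_summable])
      fix n
      have "(\<rho> ^ Suc j) ^ n \<le> \<rho> ^ n"
        using assms(5,6) by (intro power_mono) (auto intro: mult_left_le power_le_one)
      then show "norm (fps_nth C n * (\<rho> ^ Suc j) ^ n) \<le> fps_nth C n * \<rho> ^ n"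
        using assms(5) C.c_nonneg by (simp add: abs_mult mult_left_mono)
    qed
    from eval_fps_tail_series [of m, OF low this]
    have "eval_fps C (\<rho> ^ Suc j) - fps_nth C m * \<rho> ^ (Suc j * m) = \<rho> ^ (Suc j * m) * s (Suc j)"
      using assms(5) s_eq [of "Suc j"] unfolding power_mult E_def by simp
    then show ?thesis
      using assms(5) unfolding A_term_def by (simp del: of_nat_Suc power_Suc)
  qed
  have A: "A_const C \<rho> m = B / Gamma a"
    by (simp add: A_const_def A_term B_def C_nth a_def)
  have "B > 0" "Gamma a > 0"
    using \<open>a > 0\<close> by (simp_all add: B_def Gamma_real_pos)
  show ?thesis
  proof (intro conjI allI impI)
    show "summable (\<lambda>j. A_term C \<rho> m (Suc j))"
      unfolding A_term by (rule s_summable)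
  next
    fix n N :: "nat \<Rightarrow> nat"
    assume pos: "\<forall>i. n i \<ge> 1 \<and> N i \<ge> 1"
      and N: "filterlim N at_top sequentially"
      and diff: "filterlim (\<lambda>i. int (n i) - int m * int (N i)) at_top sequentially"
    \<comment> \<open>Truncated subtraction, equal to the true difference for all large i because
      that difference tends to infinity.\<close>
    define r where "r = (\<lambda>i. n i - m * N i)"
    have "filterlim (\<lambda>i. nat (int (n i) - int m * int (N i))) at_top sequentially"
      by (rule filterlim_compose [OF filterlim_nat_sequentially diff])
    moreover have "nat (int (n i) - int m * int (N i)) = r i" for i
      unfolding r_def of_nat_mult [symmetric] by linarith
    ultimately have r: "filterlim r at_top sequentially"
      by simp
    define T where "T = (\<lambda>i. (\<Sum>M\<le>N i. rising a (N i - M) * fps_nth (P M) (r i))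
      / (rising a (N i) * fps_nth C (r i)))"
    define U where "U = (\<lambda>i. rising a (N i) / real (N i) powr (a - 1))"
    define V where "V = (\<lambda>i. fps_nth C (r i + m) / fps_nth C (r i))"
    have "T \<longlonglongrightarrow> 1 / \<rho> ^ m * B"
      unfolding T_def B_def by (rule rising_convolution_asymp [OF \<open>a > 0\<close> r N])
    moreover have "U \<longlonglongrightarrow> 1 / Gamma a"
      unfolding U_def by (rule filterlim_compose [OF rising_asymp [OF \<open>a > 0\<close>] N])
    moreover have "V \<longlonglongrightarrow> 1 / \<rho> ^ m"
      unfolding V_def by (rule filterlim_compose [OF C.c_add_ratio r])
    \<comment> \<open>T compares the coefficient with \<open>rising a (N i)\<close> and c (r i), U
      passes from \<open>rising\<close> to the power of N, and V from c (r i) to c (r i + m). The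
      factors \<rho>^(-m) in the limits of T and V cancel.\<close>
    ultimately have "(\<lambda>i. T i * U i / (B / Gamma a * V i))
        \<longlonglongrightarrow> (1 / \<rho> ^ m * B) * (1 / Gamma a) / (B / Gamma a * (1 / \<rho> ^ m))"
      using \<open>B > 0\<close> \<open>Gamma a > 0\<close> assms(5) by (intro tendsto_intros) auto
    also have "(1 / \<rho> ^ m * B) * (1 / Gamma a) / (B / Gamma a * (1 / \<rho> ^ m)) = 1"
      using \<open>B > 0\<close> \<open>Gamma a > 0\<close> assms(5) by simp
    finally have "(\<lambda>i. T i * U i / (B / Gamma a * V i)) \<longlonglongrightarrow> 1" .
    moreover have "\<forall>\<^sub>F i in sequentially. T i * U i / (B / Gamma a * V i)
        = coeff_xy (G_series C) (n i) (N i) /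
            (A_const C \<rho> m * real (N i) powr (c m - 1) * c (n i - m * (N i - 1)))"
      using eventually_compose_filterlim [OF C.c_eventually_pos r]
        eventually_compose_filterlim [OF eventually_ge_at_top [of 0] diff]
    proof eventually_elim
      case (elim i)
      have "int (m * N i) \<le> int (n i)" using elim(2) by simp
      then have le: "m * N i \<le> n i" by (simp only: of_nat_le_iff)
      \<comment> \<open>Both subtractions are exact here, by N i \<ge> 1 and m * N i \<le> n
        i.\<close>
      then have shift: "n i - m * (N i - 1) = r i + m"
        using pos by (cases "N i") (auto simp: r_def dest: spec [of _ i])
      have coeff: "coeff_xy (G_series C) (n i) (N i)
          = (\<Sum>M\<le>N i. rising a (N i - M) * fps_nth (P M) (r i))"
        using le unfolding coeff_xy_def factor
        by (simp add: fps_X_power_mult_nth fps_sum_nth r_def)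
      have "rising a (N i) \<noteq> 0" using \<open>a > 0\<close> by simp
      with elim(1) show ?case
        unfolding coeff shift A T_def U_def V_def by (simp add: C_nth a_def)
    qed
    ultimately show "(\<lambda>i. coeff_xy (G_series C) (n i) (N i) /
            (A_const C \<rho> m * real (N i) powr (c m - 1) * c (n i - m * (N i - 1))))
        \<longlonglongrightarrow> 1"
      by (rule Lim_transform_eventually)
  qed
qed

end
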